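(* Let $\rho>0$ be a real number. Then the following hold. (1) For each given integer $j\ge 0$, the function $$t\mapsto\binom{t+\rho+j}{\rho}\frac{\zeta(t+\rho)}{\zeta(t)}$$ is increasing from $(1,\infty)$ onto $(0,\infty)$. (2) For each given integer $j\ge 0$, the function $t\mapsto\Gamma(t+j)\zeta(t)$ is absolutely convex in $t\in(1,\infty)$. (3) For each given integer $j\ge 1$, the function $t\mapsto\Gamma(t+j)\zeta(t)$ is logarithmically convex in $t\in(1,\infty)$.
   Context: $\Gamma$ denotes the Euler gamma function and $\zeta(t)=\sum_{k=1}^{\infty}k^{-t}$ for $t>1$ denotes the Riemann zeta function. The extended binomial coefficient is defined by $\binom{z}{w}=\frac{\Gamma(z+1)}{\Gamma(w+1)\Gamma(z-w+1)}$ whenever none of $z$, $w$, $z-w$ is a negative integer (this is the only case occurring here); thus $\binom{t+\rho+j}{\rho}=\frac{\Gamma(t+\rho+j+1)}{\Gamma(\rho+1)\Gamma(t+j+1)}$. A real function $g$, infinitely differentiable on an interval $I\subseteq\mathbb{R}$, is called absolutely convex on $I$ if $g^{(2k)}(t)\ge 0$ for all integers $k\ge 0$ and all $t\in I$. A positive function $g$ on $I$ is logarithmically convex if $\ln g$ is convex on $I$. *)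

theory Defs
  imports "HOL-Analysis.Analysis"
begin

(* The Dirichlet series converges exactly for t > 1; elsewhere the value is junk. *)
definition zeta :: "real \<Rightarrow> real" where
  "zeta t = (\<Sum>k. 1 / real (Suc k) powr t)"

(* Meant for the case that none of z, w, z - w is a negative integer.  The library's
   gchoose only allows a natural number as lower argument. *)
definition ext_binomial :: "real \<Rightarrow> real \<Rightarrow> real" where
  "ext_binomial z w = Gamma (z + 1) / (Gamma (w + 1) * Gamma (z - w + 1))"

(* D n is the n-th derivative of g on I, one-sided at endpoints belonging to I.  As I is a
   nondegenerate interval, D is uniquely determined on I, so the existential quantifier
   says that g is infinitely differentiable on I and does not leave a choice of D. *)
definition absolutely_convex_on :: "real set \<Rightarrow> (real \<Rightarrow> real) \<Rightarrow> bool" where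
  "absolutely_convex_on I g \<longleftrightarrow>
     is_interval I \<and> interior I \<noteq> {} \<and>
     (\<exists>D :: nat \<Rightarrow> real \<Rightarrow> real.
        (\<forall>t\<in>I. D 0 t = g t) \<and>
        (\<forall>n. \<forall>t\<in>I. (D n has_real_derivative D (Suc n) t) (at t within I)) \<and>
        (\<forall>k. \<forall>t\<in>I. D (2 * k) t \<ge> 0))"

definition log_convex_on :: "real set \<Rightarrow> (real \<Rightarrow> real) \<Rightarrow> bool" where
  "log_convex_on I g \<longleftrightarrow> (\<forall>t\<in>I. g t > 0) \<and> convex_on I (\<lambda>t. ln (g t))"

end

theory Submission
  imports Defs
begin

text \<open>
  Everything rests on one integral representation.  Expanding the zeta function and using
  \<open>Gamma s / n powr s = \<integral> x powr (s - 1) * exp (- n * x) dx\<close> for every term shows that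
  \<open>Gamma (t + j) * zeta t\<close> is the integral of \<open>exp (t * ln x)\<close> against a positive measure on the positive
  half-line that depends on \<open>j\<close> but not on \<open>t\<close> (\<open>nn_integral_zeta_measure\<close>).

  Functions \<open>F t = \<integral> exp (t * Y) dM\<close> have the required convexity properties wherever the integral converges on
  an open half-line of parameters, whatever the measure \<open>M\<close>, provided that \<open>Y\<close> is not almost everywhere constant.
  They may be differentiated under the integral sign (\<open>moment_has_derivative\<close>), and the derivatives of even
  order are integrals of \<open>Y ^ (2 * k) * exp (t * Y)\<close>, hence nonnegative.  By the equality case of
  the Hoelder inequality \<open>ln F\<close> is strictly convex (\<open>ln_moment_strictly_convex\<close>).  This settles absolute and logarithmic convexity.

  The function in the first claim is \<open>F (t + \<rho>) / F t\<close> up to the constant factor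
  \<open>1 / Gamma (\<rho> + 1)\<close>, where \<open>F\<close> belongs to the index \<open>j + 1\<close>.  Strict convexity of
  \<open>ln F\<close> makes it strictly increasing (\<open>moment_ratio_strict_mono\<close>).  It is onto the positive reals by the
  intermediate value theorem: it tends to 0 at 1, where the zeta function has its pole, and is unbounded
  because the quotient of the two Gamma values is (\<open>Gamma_quotient_lower_bound\<close>).
\<close>

section \<open>Inequalities for the exponential function\<close>

text \<open>A quadratic error bound with an explicit integrable majorant, for differentiating under the
  integral sign.  It follows from \<open>1 + z \<le> exp z\<close> alone, applied to
  \<open>z\<close> and to \<open>- z\<close>.\<close>

lemma exp_taylor_bound: "\<bar>exp z - 1 - z\<bar> \<le> z\<^sup>2 * exp \<bar>z\<bar>" for z :: real
proof -
  have *: "exp w - 1 \<le> w * exp w" for w :: real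
  proof -
    have "(1 - w) * exp w \<le> exp (- w) * exp w"
      using exp_ge_add_one_self[of "- w"] by (intro mult_right_mono) auto
    then show ?thesis by (simp add: exp_minus field_simps)
  qed
  have "exp z - 1 - z \<le> z * (exp z - 1)"
    using *[of z] by (simp add: algebra_simps)
  also have "\<dots> \<le> z\<^sup>2 * exp \<bar>z\<bar>"
  proof (cases "z \<ge> 0")
    case True
    then show ?thesis using mult_left_mono[OF *[of z], of z]
      by (simp add: power2_eq_square mult.assoc)
  next
    case False
    then have "z * (exp z - 1) \<le> z * z"
      using exp_ge_add_one_self[of z] by (intro mult_left_mono_neg) linarith+
    also have "\<dots> \<le> z * z * exp \<bar>z\<bar>"
      using mult_left_mono[of 1 "exp \<bar>z\<bar>" "z * z"] by simp
    finally show ?thesis by (simp add: power2_eq_square)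
  qed
  finally show ?thesis
    using exp_ge_add_one_self[of z] by linarith
qed

lemma power_le_fact_exp: "x ^ n \<le> fact n * exp x" if "x \<ge> 0" for x :: real
proof -
  have "(\<Sum>k\<in>{n}. x ^ k /\<^sub>R fact k) \<le> (\<Sum>k. x ^ k /\<^sub>R fact k)"
    using that summable_exp_generic[of x] by (intro sum_le_suminf) auto
  then show ?thesis by (simp add: exp_def field_simps)
qed

text \<open>Put \<open>r = (1 - u) * p + u * q\<close> and factor out \<open>exp r\<close>: the gap in the convexity inequality is
  \<open>exp r\<close> times a weighted mean of \<open>exp z - 1 - z\<close> at \<open>z = p - r\<close> and \<open>z = q - r\<close>, and this
  function is nonnegative and vanishes only at \<open>z = 0\<close>.\<close>

lemma exp_strictly_convex:
  fixes u p q :: real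
  assumes "0 < u" "u < 1"
  shows "exp ((1 - u) * p + u * q) \<le> (1 - u) * exp p + u * exp q"
    and "exp ((1 - u) * p + u * q) = (1 - u) * exp p + u * exp q \<Longrightarrow> p = q"
proof -
  define r where "r = (1 - u) * p + u * q"
  have split: "exp z = exp r * exp (z - r)" for z
    by (simp add: mult_exp_exp)
  have *: "(1 - u) * exp p + u * exp q - exp r
      = exp r * ((1 - u) * (exp (p - r) - 1 - (p - r)) + u * (exp (q - r) - 1 - (q - r)))"
    unfolding split[of p] split[of q] by (simp add: r_def algebra_simps)
  have nonneg: "exp z - 1 - z \<ge> 0" for z :: real
    using exp_ge_add_one_self[of z] by linarith
  have "(1 - u) * exp p + u * exp q - exp r \<ge> 0"
    unfolding * using nonneg assms by simp
  then show "exp ((1 - u) * p + u * q) \<le> (1 - u) * exp p + u * exp q"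
    by (simp add: r_def)
  assume "exp ((1 - u) * p + u * q) = (1 - u) * exp p + u * exp q"
  then have "(1 - u) * (exp (p - r) - 1 - (p - r)) + u * (exp (q - r) - 1 - (q - r)) = 0"
    using * exp_not_eq_zero[of r] unfolding r_def[symmetric] by simp
  then have "exp (p - r) - 1 - (p - r) = 0" "exp (q - r) - 1 - (q - r) = 0"
    using assms nonneg[of "p - r"] nonneg[of "q - r"]
    by (simp_all add: add_nonneg_eq_0_iff)
  moreover have "z = 0" if "exp z - 1 - z = 0" for z :: real
    using ln_eq_minus_one[of "exp z"] that by simp
  ultimately have "p - r = 0" "q - r = 0" by blast+
  then show "p = q" by simp
qed

section \<open>Integrals of exponentials with a real parameter\<close>

text \<open>The setting covers Mellin transforms: with \<open>Y = ln\<close> on the positive half-line,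
  \<open>exp (t * Y x)\<close> is \<open>x powr t\<close>.  Integrability is required on an open half-line of exponents so that
  there is room to move \<open>t\<close> both ways, which is what makes all moments finite.\<close>

locale exp_moments =
  fixes M :: "'a measure" and Y :: "'a \<Rightarrow> real" and a :: real
  assumes measurable_Y [measurable]: "Y \<in> borel_measurable M"
    and integrable_exp: "a < t \<Longrightarrow> integrable M (\<lambda>x. exp (t * Y x))"
begin

definition moment :: "nat \<Rightarrow> real \<Rightarrow> real" where
  "moment n t = (\<integral>x. Y x ^ n * exp (t * Y x) \<partial>M)"

text \<open>An additional factor \<open>exp (d * \<bar>y\<bar>)\<close> costs only a shift of the exponent by \<open>d\<close> in one of the two
  directions, depending on the sign of \<open>y\<close>; the sum covers both cases.\<close>

lemma exp_widen:
  fixes t d y :: real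
  shows "exp (t * y) * exp (d * \<bar>y\<bar>) \<le> exp ((t + d) * y) + exp ((t - d) * y)"
  by (cases "y \<ge> 0") (simp_all add: exp_add[symmetric] algebra_simps)

text \<open>The power \<open>\<bar>Y\<bar> ^ n\<close> is dominated by a multiple of \<open>exp (d * \<bar>Y\<bar>)\<close>, which is absorbed by widening the
  exponent within the half-line of integrability.\<close>

lemma integrable_moment_abs:
  assumes "a < t"
  shows "integrable M (\<lambda>x. \<bar>Y x\<bar> ^ n * exp (t * Y x))"
proof -
  define d where "d = (t - a) / 2"
  have d: "d > 0" "a < t - d" "a < t + d"
    using assms by (auto simp: d_def field_simps)
  have "integrable M (\<lambda>x. fact n / d ^ n * (exp ((t + d) * Y x) + exp ((t - d) * Y x)))"
    by (intro integrable_mult_right Bochner_Integration.integrable_add integrable_exp d)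
  then show ?thesis
  proof (rule Bochner_Integration.integrable_bound)
    show "AE x in M. norm (\<bar>Y x\<bar> ^ n * exp (t * Y x))
        \<le> norm (fact n / d ^ n * (exp ((t + d) * Y x) + exp ((t - d) * Y x)))"
    proof (rule AE_I2)
      fix x
      have "d ^ n * \<bar>Y x\<bar> ^ n \<le> fact n * exp (d * \<bar>Y x\<bar>)"
        using power_le_fact_exp[of "d * \<bar>Y x\<bar>" n] d by (simp add: power_mult_distrib)
      then have "\<bar>Y x\<bar> ^ n \<le> fact n / d ^ n * exp (d * \<bar>Y x\<bar>)"
        using d by (simp add: field_simps)
      then have "\<bar>Y x\<bar> ^ n * exp (t * Y x) \<le> fact n / d ^ n * exp (d * \<bar>Y x\<bar>) * exp (t * Y x)"
        by (intro mult_right_mono) auto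
      also have "\<dots> = fact n / d ^ n * (exp (t * Y x) * exp (d * \<bar>Y x\<bar>))"
        by simp
      also have "\<dots> \<le> fact n / d ^ n * (exp ((t + d) * Y x) + exp ((t - d) * Y x))"
        using d by (intro mult_left_mono exp_widen) auto
      finally show "norm (\<bar>Y x\<bar> ^ n * exp (t * Y x))
        \<le> norm (fact n / d ^ n * (exp ((t + d) * Y x) + exp ((t - d) * Y x)))"
        using d by simp
    qed
  qed measurable
qed

lemma integrable_moment:
  assumes "a < t"
  shows "integrable M (\<lambda>x. Y x ^ n * exp (t * Y x))"
  by (rule Bochner_Integration.integrable_bound[OF integrable_moment_abs[OF assms, of n]])
    (auto simp: abs_mult power_abs)

text \<open>By \<open>exp_taylor_bound\<close>, for small \<open>h\<close> the difference quotient of \<open>Y ^ n * exp (t * Y)\<close> in \<open>t\<close> differs from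
  its derivative by at most \<open>\<bar>h\<bar>\<close> times a fixed function, which is a sum of two integrands of absolute moments of
  order \<open>n + 2\<close> at the shifted parameters.  So the error after integration is \<open>O(h)\<close>.\<close>

lemma moment_has_derivative:
  assumes "a < t"
  shows "(moment n has_real_derivative moment (Suc n) t) (at t)"
proof -
  define d where "d = (t - a) / 2"
  have d: "d > 0" "a < t - d" "a < t + d"
    using assms by (auto simp: d_def field_simps)
  define g where "g = (\<lambda>x. \<bar>Y x\<bar> ^ (n + 2) * (exp ((t + d) * Y x) + exp ((t - d) * Y x)))"
  have g: "integrable M g"
    unfolding g_def distrib_left
    by (intro Bochner_Integration.integrable_add integrable_moment_abs d)
  have bound: "\<bar>(moment n (t + h) - moment n t) / h - moment (Suc n) t\<bar> \<le> \<bar>h\<bar> * (\<integral>x. g x \<partial>M)"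
    if h: "h \<noteq> 0" "\<bar>h\<bar> < d" for h
  proof -
    have th: "a < t + h" using h d by auto
    have "(moment n (t + h) - moment n t) / h - moment (Suc n) t =
        (\<integral>x. (Y x ^ n * exp ((t + h) * Y x) - Y x ^ n * exp (t * Y x)) / h
           - Y x ^ Suc n * exp (t * Y x) \<partial>M)"
      unfolding moment_def using integrable_moment[OF th, of n] integrable_moment[OF assms, of n]
        integrable_moment[OF assms, of "Suc n"]
      by (simp del: power_Suc)
    also have "\<bar>\<dots>\<bar> \<le> (\<integral>x. \<bar>h\<bar> * g x \<partial>M)"
    proof (rule integral_abs_bound[THEN order_trans], rule integral_mono)
      show "integrable M (\<lambda>x. \<bar>(Y x ^ n * exp ((t + h) * Y x) - Y x ^ n * exp (t * Y x)) / h
           - Y x ^ Suc n * exp (t * Y x)\<bar>)"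
        by (intro integrable_abs Bochner_Integration.integrable_diff integrable_divide
            integrable_moment th assms)
      show "integrable M (\<lambda>x. \<bar>h\<bar> * g x)" using g by simp
      fix x
      define y where "y = Y x"
      have "\<bar>(y ^ n * exp ((t + h) * y) - y ^ n * exp (t * y)) / h - y ^ Suc n * exp (t * y)\<bar>
          = \<bar>y ^ n * exp (t * y) * (exp (h * y) - 1 - h * y) / h\<bar>"
        using h by (simp add: field_simps exp_add)
      also have "\<dots> = \<bar>y\<bar> ^ n * exp (t * y) * \<bar>exp (h * y) - 1 - h * y\<bar> / \<bar>h\<bar>"
        by (simp add: abs_mult power_abs)
      also have "\<dots> \<le> \<bar>y\<bar> ^ n * exp (t * y) * ((h * y)\<^sup>2 * exp \<bar>h * y\<bar>) / \<bar>h\<bar>"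
        by (intro divide_right_mono mult_left_mono exp_taylor_bound) auto
      also have "\<dots> = \<bar>h\<bar> * (\<bar>y\<bar> ^ (n + 2) * (exp (t * y) * exp (\<bar>h\<bar> * \<bar>y\<bar>)))"
        using h by (simp add: abs_mult power_mult_distrib power_add power2_eq_square field_simps)
      also have "\<dots> \<le> \<bar>h\<bar> * (\<bar>y\<bar> ^ (n + 2) * (exp (t * y) * exp (d * \<bar>y\<bar>)))"
        using h by (intro mult_left_mono) (auto intro: mult_right_mono)
      also have "\<dots> \<le> \<bar>h\<bar> * (\<bar>y\<bar> ^ (n + 2) * (exp ((t + d) * y) + exp ((t - d) * y)))"
        by (intro mult_left_mono exp_widen) auto
      finally show "\<bar>(Y x ^ n * exp ((t + h) * Y x) - Y x ^ n * exp (t * Y x)) / h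
           - Y x ^ Suc n * exp (t * Y x)\<bar> \<le> \<bar>h\<bar> * g x"
        by (simp add: y_def g_def)
    qed
    finally show ?thesis by simp
  qed
  have "((\<lambda>h. (moment n (t + h) - moment n t) / h - moment (Suc n) t) \<longlongrightarrow> 0) (at 0)"
  proof (rule Lim_null_comparison)
    show "((\<lambda>h. \<bar>h\<bar> * (\<integral>x. g x \<partial>M)) \<longlongrightarrow> 0) (at 0)"
      by (auto intro!: tendsto_eq_intros)
    show "\<forall>\<^sub>F h in at 0. norm ((moment n (t + h) - moment n t) / h - moment (Suc n) t)
        \<le> \<bar>h\<bar> * (\<integral>x. g x \<partial>M)"
      unfolding eventually_at using bound d(1) by (auto simp: dist_real_def intro!: exI[of _ d])
  qed
  then show ?thesis
    unfolding DERIV_def by (rule LIM_zero_cancel)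
qed

lemma moment_even_nonneg: "moment (2 * k) t \<ge> 0"
  unfolding moment_def by (intro Bochner_Integration.integral_nonneg mult_nonneg_nonneg) auto

lemma absolutely_convex_moment: "absolutely_convex_on {a<..} (moment 0)"
  unfolding absolutely_convex_on_def
proof (intro conjI exI[of _ moment] ballI allI)
  show "is_interval {a<..}"
    by (simp add: is_interval_convex_1)
  show "interior {a<..} \<noteq> {}"
    using gt_ex[of a] by (auto simp: interior_open)
  show "(moment n has_real_derivative moment (Suc n) t) (at t within {a<..})" if "t \<in> {a<..}" for n t
    using moment_has_derivative that by (auto intro: has_field_derivative_at_within)
qed (simp_all add: moment_even_nonneg)

end

locale nonconstant_exp_moments = exp_moments +
  assumes nonconstant: "\<not> (AE x in M. Y x = c)"
begin

lemma moment_0_pos: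
  assumes "a < t"
  shows "moment 0 t > 0"
proof -
  have "\<not> (AE x in M. exp (t * Y x) = 0)"
    using nonconstant[of 0] by (metis (mono_tags, lifting) AE_mp AE_I2 exp_not_eq_zero)
  then have "moment 0 t \<noteq> 0"
    unfolding moment_def
    using integral_nonneg_eq_0_iff_AE[OF integrable_exp[OF assms]] by simp
  with moment_even_nonneg[of 0 t] show ?thesis by simp
qed

text \<open>This is the strict Hoelder inequality.  Normalise both exponentials to have integral 1, that is, subtract
  \<open>A = ln (moment 0 s)\<close> and \<open>B = ln (moment 0 t)\<close> in the exponents, and integrate the pointwise convexity
  inequality of \<open>exp\<close>.  Equality would force \<open>s * Y - A = t * Y - B\<close> almost everywhere and hence make \<open>Y\<close>
  constant.\<close>

lemma ln_moment_strictly_convex: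
  assumes "a < s" "a < t" "s \<noteq> t" "0 < u" "u < 1"
  shows "ln (moment 0 ((1 - u) * s + u * t)) < (1 - u) * ln (moment 0 s) + u * ln (moment 0 t)"
proof -
  define m where "m = (1 - u) * s + u * t"
  define A where "A = ln (moment 0 s)"
  define B where "B = ln (moment 0 t)"
  have "(1 - u) * a + u * a < m"
    unfolding m_def using assms by (intro add_strict_mono mult_strict_left_mono) auto
  then have m: "a < m" by (simp add: algebra_simps)
  have AB: "exp A = moment 0 s" "exp B = moment 0 t"
    using assms moment_0_pos by (auto simp: A_def B_def)
  define f where "f = (\<lambda>x. exp (- (1 - u) * A - u * B) * exp (m * Y x))"
  define g where "g = (\<lambda>x. (1 - u) * (exp (- A) * exp (s * Y x)) + u * (exp (- B) * exp (t * Y x)))"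
  have f: "f x = exp ((1 - u) *\<^sub>R (s * Y x - A) + u *\<^sub>R (t * Y x - B))" for x
    by (simp add: f_def m_def mult_exp_exp algebra_simps)
  have g: "g x = (1 - u) * exp (s * Y x - A) + u * exp (t * Y x - B)" for x
    by (simp add: g_def mult_exp_exp algebra_simps)
  have le: "f x \<le> g x" and eqD: "f x = g x \<Longrightarrow> s * Y x - A = t * Y x - B" for x
    using exp_strictly_convex[of u "s * Y x - A" "t * Y x - B"] assms
    by (auto simp: f g algebra_simps)
  have int_f: "integrable M f" and int_g: "integrable M g"
    unfolding f_def g_def using integrable_exp assms m by auto
  have "integral\<^sup>L M f \<noteq> integral\<^sup>L M g"
  proof
    assume "integral\<^sup>L M f = integral\<^sup>L M g"
    then have "(\<integral>x. g x - f x \<partial>M) = 0"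
      using int_f int_g by simp
    then have "AE x in M. g x - f x = 0"
      using int_f int_g le by (subst (asm) integral_nonneg_eq_0_iff_AE) auto
    then have "AE x in M. Y x = (A - B) / (s - t)"
      by eventually_elim (use eqD assms in \<open>auto simp: field_simps\<close>)
    with nonconstant show False by blast
  qed
  moreover have "integral\<^sup>L M f \<le> integral\<^sup>L M g"
    by (intro integral_mono int_f int_g le)
  moreover have "integral\<^sup>L M g = (1 - u) * (exp (- A) * exp A) + u * (exp (- B) * exp B)"
    unfolding AB g_def moment_def using integrable_exp assms by simp
  moreover have "\<dots> = 1"
    by (simp add: mult_exp_exp)
  moreover have "integral\<^sup>L M f = exp (- (1 - u) * A - u * B) * moment 0 m"
    unfolding f_def moment_def by simp
  ultimately have "exp (- (1 - u) * A - u * B) * moment 0 m < 1"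
    by linarith
  then have "exp (- ((1 - u) * A + u * B)) * exp (ln (moment 0 m)) < exp 0"
    using moment_0_pos[OF m] by (simp add: algebra_simps)
  then show ?thesis
    unfolding mult_exp_exp exp_less_cancel_iff by (simp add: m_def A_def B_def)
qed

lemma log_convex_moment: "log_convex_on {a<..} (moment 0)"
  unfolding log_convex_on_def
proof (intro conjI ballI convex_onI)
  fix u s t :: real
  assume *: "0 < u" "u < 1" "s \<in> {a<..}" "t \<in> {a<..}"
  show "ln (moment 0 ((1 - u) *\<^sub>R s + u *\<^sub>R t)) \<le> (1 - u) * ln (moment 0 s) + u * ln (moment 0 t)"
    using ln_moment_strictly_convex[of s t u] * by (cases "s = t") (auto simp: algebra_simps)
qed (use moment_0_pos in auto)

text \<open>For strictly convex \<open>L\<close> the increment \<open>L (t + \<rho>) - L t\<close> is strictly increasing: both \<open>t\<close> and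
  \<open>s + \<rho>\<close> lie strictly between \<open>s\<close> and \<open>t + \<rho>\<close>, with complementary weights, so adding the two convexity
  inequalities gives \<open>L t + L (s + \<rho>) < L s + L (t + \<rho>)\<close>.\<close>

lemma moment_ratio_strict_mono:
  assumes "\<rho> > 0"
  shows "strict_mono_on {a<..} (\<lambda>t. moment 0 (t + \<rho>) / moment 0 t)"
proof (rule strict_mono_onI)
  fix s t assume st: "s \<in> {a<..}" "t \<in> {a<..}" "s < t"
  define L where "L = (\<lambda>r. ln (moment 0 r))"
  \<comment> \<open>the weight of \<open>t + \<rho>\<close> when \<open>t\<close> is written as a mean of \<open>s\<close> and \<open>t + \<rho>\<close>\<close>
  define u where "u = (t - s) / (t - s + \<rho>)"
  have u: "0 < u" "u < 1"
    using st assms by (auto simp: u_def)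
  have "u * (t - s + \<rho>) = t - s"
    using st assms by (simp add: u_def)
  then have eqs: "(1 - u) * s + u * (t + \<rho>) = t" "(1 - (1 - u)) * s + (1 - u) * (t + \<rho>) = s + \<rho>"
    by (simp_all add: algebra_simps)
  have "L t < (1 - u) * L s + u * L (t + \<rho>)"
    using ln_moment_strictly_convex[of s "t + \<rho>" u] st assms u unfolding eqs L_def by simp
  moreover have "L (s + \<rho>) < u * L s + (1 - u) * L (t + \<rho>)"
    using ln_moment_strictly_convex[of s "t + \<rho>" "1 - u"] st assms u unfolding eqs L_def by simp
  ultimately have "L (s + \<rho>) - L s < L (t + \<rho>) - L t"
    by (simp add: algebra_simps)
  then have "exp (L (s + \<rho>) - L s) < exp (L (t + \<rho>) - L t)"
    by simp
  then show "moment 0 (s + \<rho>) / moment 0 s < moment 0 (t + \<rho>) / moment 0 t"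
    using st assms moment_0_pos by (simp add: exp_diff L_def)
qed

end

section \<open>The zeta function and the measure that represents it\<close>

lemma nn_integral_Gamma_scaled:
  fixes s c :: real
  assumes "s > 0" "c > 0"
  shows "(\<integral>\<^sup>+x. ennreal (indicator {0<..} x * x powr (s - 1) * exp (- c * x)) \<partial>lborel)
    = ennreal (Gamma s / c powr s)"
proof -
  define f where "f = (\<lambda>x::real. ennreal (indicator {0<..} x * x powr (s - 1) * exp (- x)))"
  have f_meas: "f \<in> borel_measurable borel" unfolding f_def by measurable
  have "ennreal (Gamma s) = (\<integral>\<^sup>+x. f x \<partial>lborel)"
    unfolding Gamma_conv_nn_integral_real[OF assms(1)] f_def
    by (intro nn_integral_cong_AE AE_I[where N = "{0}"])
      (auto simp: indicator_def exp_minus field_simps split: if_splits)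
  also have "\<dots> = c * (\<integral>\<^sup>+x. f (0 + c * x) \<partial>lborel)"
    using nn_integral_real_affine[OF f_meas, of c 0] assms by simp
  also have "(\<lambda>x. f (0 + c * x)) = (\<lambda>x. ennreal (c powr (s - 1))
      * ennreal (indicator {0<..} x * x powr (s - 1) * exp (- c * x)))"
    using assms by (auto simp: f_def fun_eq_iff indicator_def zero_less_mult_iff powr_mult
        ennreal_mult'[symmetric] algebra_simps)
  also have "ennreal c * (\<integral>\<^sup>+x. ennreal (c powr (s - 1))
      * ennreal (indicator {0<..} x * x powr (s - 1) * exp (- c * x)) \<partial>lborel)
    = ennreal (c * c powr (s - 1)) *
      (\<integral>\<^sup>+x. ennreal (indicator {0<..} x * x powr (s - 1) * exp (- c * x)) \<partial>lborel)"
    using assms by (subst nn_integral_cmult) (auto simp: ennreal_mult' mult.assoc)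
  also have "c * c powr (s - 1) = c powr s"
    using assms powr_mult_base[of c "s - 1"] by simp
  finally have "ennreal (Gamma s) = ennreal (c powr s) *
      (\<integral>\<^sup>+x. ennreal (indicator {0<..} x * x powr (s - 1) * exp (- c * x)) \<partial>lborel)" .
  moreover have "ennreal (Gamma s) = ennreal (c powr s) * ennreal (Gamma s / c powr s)"
    using assms by (simp add: ennreal_mult'[symmetric])
  ultimately show ?thesis
    using assms by (metis ennreal_mult_cancel_left ennreal_eq_0_iff ennreal_neq_top not_le
        powr_gt_zero less_irrefl)
qed

lemma zeta_sums:
  assumes "t > 1"
  shows "(\<lambda>k. 1 / real (Suc k) powr t) sums zeta t"
proof -
  have "summable (\<lambda>k. real (Suc k) powr (- t))"
    using assms by (subst summable_Suc_iff) (simp add: summable_real_powr_iff)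
  then show ?thesis
    unfolding zeta_def by (simp add: powr_minus_divide summable_sums)
qed

lemma zeta_ge_1: "zeta t \<ge> 1" if "t > 1"
  using sum_le_suminf[OF sums_summable[OF zeta_sums[OF that]], of "{0}"] by (simp add: zeta_def)

lemma zeta_antimono:
  assumes "1 < s" "s \<le> t"
  shows "zeta t \<le> zeta s"
proof (rule sums_le[OF _ zeta_sums zeta_sums])
  show "1 / real (Suc k) powr t \<le> 1 / real (Suc k) powr s" for k
    using assms by (intro divide_left_mono powr_mono) auto
qed (use assms in auto)

text \<open>Near \<open>t = 1\<close> every finite partial sum is close to a harmonic number, and these are unbounded.\<close>

lemma zeta_at_top_at_right_1: "filterlim zeta at_top (at_right 1)"
  unfolding filterlim_at_top
proof
  fix C :: real
  have "\<forall>\<^sub>F n in sequentially. harm n \<ge> C + 1"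
    using harm_at_top by (auto simp: filterlim_at_top)
  then obtain n where n: "harm n \<ge> C + 1"
    by (auto simp: eventually_sequentially)
  have "((\<lambda>t. \<Sum>k<n. 1 / real (Suc k) powr t) \<longlongrightarrow> (\<Sum>k<n. 1 / real (Suc k) powr 1)) (at_right 1)"
    by (intro tendsto_intros) auto
  also have "(\<Sum>k<n. 1 / real (Suc k) powr 1) = harm n"
    by (simp add: harm_altdef inverse_eq_divide)
  finally have "\<forall>\<^sub>F t in at_right 1. C < (\<Sum>k<n. 1 / real (Suc k) powr t)"
    by (rule order_tendstoD) (use n in auto)
  moreover have "\<forall>\<^sub>F t::real in at_right 1. t > 1"
    by (simp add: eventually_at_right_less)
  ultimately show "\<forall>\<^sub>F t in at_right 1. C \<le> zeta t"
  proof eventually_elim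
    case (elim t)
    have "(\<Sum>k<n. 1 / real (Suc k) powr t) \<le> zeta t"
      unfolding zeta_def using zeta_sums[OF elim(2)]
      by (intro sum_le_suminf) (auto simp: sums_iff)
    with elim show ?case by simp
  qed
qed

text \<open>For positive \<open>x\<close> this is \<open>x powr (j - 1)\<close> times \<open>(-1) ^ j\<close> times the \<open>j\<close>-th derivative of
  \<open>1 / (exp x - 1) = (\<Sum>k. exp (- (k + 1) * x))\<close>, written as a series so that it can be integrated term by
  term.  The values are extended nonnegative reals, which makes summability a non-issue.\<close>

definition zeta_density :: "nat \<Rightarrow> real \<Rightarrow> ennreal" where
  "zeta_density j x = (\<Sum>k. ennreal
     (indicator {0<..} x * real (Suc k) ^ j * x powr (real j - 1) * exp (- real (Suc k) * x)))"

definition zeta_measure :: "nat \<Rightarrow> real measure" where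
  "zeta_measure j = density lborel (zeta_density j)"

lemma measurable_zeta_density [measurable]: "zeta_density j \<in> borel_measurable borel"
  unfolding zeta_density_def by measurable

lemma zeta_density_pos:
  assumes "x > 0"
  shows "zeta_density j x > 0"
proof -
  define f where "f = (\<lambda>k. ennreal
     (indicator {0<..} x * real (Suc k) ^ j * x powr (real j - 1) * exp (- real (Suc k) * x)))"
  have "0 < f 0"
    using assms by (simp add: f_def)
  also have "f 0 = (\<Sum>k\<in>{0}. f k)"
    by simp
  also have "\<dots> \<le> suminf f"
    by (intro sum_le_suminf summableI) auto
  also have "suminf f = zeta_density j x"
    unfolding f_def zeta_density_def ..
  finally show ?thesis .
qed

text \<open>The integral representation of \<open>Gamma (t + j) * zeta t\<close>.  For \<open>n = k + 1\<close>, the term of index \<open>k\<close> of the density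
  contributes \<open>n ^ j * Gamma (t + j) / n powr (t + j)\<close>, in which the powers of \<open>n\<close> combine to
  \<open>1 / n powr t\<close>.\<close>

lemma nn_integral_zeta_measure:
  assumes "t > 1"
  shows "(\<integral>\<^sup>+x. ennreal (exp (t * ln x)) \<partial>zeta_measure j) = ennreal (Gamma (t + real j) * zeta t)"
proof -
  have "(\<integral>\<^sup>+x. ennreal (exp (t * ln x)) \<partial>zeta_measure j)
      = (\<integral>\<^sup>+x. zeta_density j x * ennreal (exp (t * ln x)) \<partial>lborel)"
    unfolding zeta_measure_def by (subst nn_integral_density) auto
  also have "\<dots> = (\<integral>\<^sup>+x. (\<Sum>k. ennreal (real (Suc k) ^ j) *
      ennreal (indicator {0<..} x * x powr (t + real j - 1) * exp (- real (Suc k) * x))) \<partial>lborel)"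
  proof (rule nn_integral_cong)
    fix x :: real
    have *: "x powr (real j - 1) * exp (t * ln x) = x powr (t + real j - 1)" if "x > 0"
      using that by (simp add: powr_def mult_exp_exp algebra_simps)
    show "zeta_density j x * ennreal (exp (t * ln x)) = (\<Sum>k. ennreal (real (Suc k) ^ j) *
      ennreal (indicator {0<..} x * x powr (t + real j - 1) * exp (- real (Suc k) * x)))"
      unfolding zeta_density_def ennreal_suminf_multc[symmetric]
      by (intro suminf_cong)
        (auto simp: indicator_def *[symmetric] ennreal_mult'[symmetric] mult_ac simp del: of_nat_Suc)
  qed
  also have "\<dots> = (\<Sum>k. ennreal (real (Suc k) ^ j) *
      ennreal (Gamma (t + real j) / real (Suc k) powr (t + real j)))"
    using assms nn_integral_Gamma_scaled[of "t + real j"]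
    by (simp add: nn_integral_suminf nn_integral_cmult del: of_nat_Suc)
  also have "\<dots> = (\<Sum>k. ennreal (Gamma (t + real j) * (1 / real (Suc k) powr t)))"
    by (intro suminf_cong)
      (simp add: ennreal_mult'[symmetric] powr_add powr_realpow del: of_nat_Suc)
  also have "\<dots> = ennreal (Gamma (t + real j) * zeta t)"
  proof (rule suminf_ennreal_eq)
    show "0 \<le> Gamma (t + real j) * (1 / real (Suc k) powr t)" for k
      using assms Gamma_real_pos[of "t + real j"] by simp
    show "(\<lambda>k. Gamma (t + real j) * (1 / real (Suc k) powr t)) sums (Gamma (t + real j) * zeta t)"
      by (intro sums_mult zeta_sums assms)
  qed
  finally show ?thesis .
qed

interpretation zeta: nonconstant_exp_moments "zeta_measure j" ln 1 for j
proof
  show "ln \<in> borel_measurable (zeta_measure j)"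
    by (simp add: zeta_measure_def)
  show "integrable (zeta_measure j) (\<lambda>x. exp (t * ln x))" if "1 < t" for t
    using nn_integral_zeta_measure[OF that, of j]
    by (intro integrableI_nonneg) (auto simp: zeta_measure_def)
  show "\<not> (AE x in zeta_measure j. ln x = c)" for c
  proof
    assume "AE x in zeta_measure j. ln x = c"
    then have "AE x in lborel. zeta_density j x > 0 \<longrightarrow> ln x = c"
      unfolding zeta_measure_def by (subst (asm) AE_density) auto
    moreover have "AE x in lborel. x \<noteq> exp c"
      by (rule AE_lborel_singleton)
    \<comment> \<open>any interval of positive numbers with known positive length would do\<close>
    ultimately have "AE x in lborel. x \<notin> {0<..<1::real}"
      by eventually_elim (use zeta_density_pos in \<open>metis exp_ln greaterThanLessThan_iff\<close>)
    then have "emeasure lborel {0<..<1::real} = 0"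
      by (subst (asm) AE_iff_measurable[of "{0<..<1}"]) auto
    then show False by simp
  qed
qed

lemma moment_zeta_measure:
  assumes "t > 1"
  shows "zeta.moment j 0 t = Gamma (t + real j) * zeta t"
proof -
  have "Gamma (t + real j) * zeta t \<ge> 0"
    using assms zeta_ge_1[OF assms] Gamma_real_pos[of "t + real j"] by simp
  moreover have "(\<lambda>x. exp (t * ln x)) \<in> borel_measurable (zeta_measure j)"
    by (simp add: zeta_measure_def)
  ultimately show ?thesis
    using nn_integral_zeta_measure[OF assms, of j]
      nn_integral_eq_integrable[of "\<lambda>x. exp (t * ln x)" "zeta_measure j"
        "Gamma (t + real j) * zeta t"]
    by (simp add: zeta.moment_def)
qed

section \<open>Quotients of Gamma and zeta values\<close>

text \<open>The slope of the convex function \<open>ln Gamma\<close> on \<open>[x, x + r]\<close> is at least its slope on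
  \<open>[x - 1, x]\<close>, and the latter is \<open>ln (x - 1)\<close> by the functional equation.\<close>

lemma Gamma_quotient_lower_bound:
  fixes x r :: real
  assumes "x > 1" "r > 0"
  shows "(x - 1) powr r \<le> Gamma (x + r) / Gamma x"
proof -
  define L where "L = (\<lambda>y::real. ln (Gamma y))"
  \<comment> \<open>the weight of \<open>x - 1\<close> when \<open>x\<close> is written as a mean of \<open>x + r\<close> and \<open>x - 1\<close>\<close>
  define u where "u = r / (1 + r)"
  have u: "0 \<le> u" "u \<le> 1" "(1 + r) * u = r" "(1 + r) * (1 - u) = 1"
    using assms by (auto simp: u_def field_simps)
  have x: "(1 - u) *\<^sub>R (x + r) + u *\<^sub>R (x - 1) = x"
    using u by (simp add: algebra_simps)
  have "L ((1 - u) *\<^sub>R (x + r) + u *\<^sub>R (x - 1)) \<le> (1 - u) * L (x + r) + u * L (x - 1)"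
    using convex_onD[OF log_convex_Gamma_real, of u "x + r" "x - 1"] assms u
    by (simp add: L_def o_def)
  then have "(1 + r) * L x \<le> (1 + r) * ((1 - u) * L (x + r) + u * L (x - 1))"
    unfolding x using assms by (intro mult_left_mono) auto
  also have "\<dots> = ((1 + r) * (1 - u)) * L (x + r) + ((1 + r) * u) * L (x - 1)"
    by (simp add: algebra_simps)
  finally have "(1 + r) * L x \<le> L (x + r) + r * L (x - 1)"
    using u by simp
  moreover have "L x = ln (x - 1) + L (x - 1)"
  proof -
    have "x - 1 \<notin> \<int>\<^sub>\<le>\<^sub>0"
      using assms by (auto elim!: nonpos_Ints_cases)
    then have "Gamma x = (x - 1) * Gamma (x - 1)"
      using Gamma_plus1[of "x - 1"] by simp
    then show ?thesis
      using assms Gamma_real_pos[of "x - 1"] by (simp add: L_def ln_mult_pos)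
  qed
  ultimately have "r * ln (x - 1) \<le> L (x + r) - L x"
    by (simp add: algebra_simps)
  then have "exp (r * ln (x - 1)) \<le> exp (L (x + r) - L x)"
    by simp
  then show ?thesis
    using assms by (simp add: powr_def exp_diff L_def Gamma_real_pos)
qed

text \<open>The index shifts from \<open>j\<close> to \<open>j + 1\<close> because the extended binomial coefficient contains
  \<open>Gamma (t + j + 1)\<close>.\<close>

lemma binomial_zeta_quotient:
  assumes "\<rho> > 0" "t > 1"
  shows "ext_binomial (t + \<rho> + real j) \<rho> * (zeta (t + \<rho>) / zeta t)
    = zeta.moment (Suc j) 0 (t + \<rho>) / zeta.moment (Suc j) 0 t / Gamma (\<rho> + 1)"
  using assms by (simp add: ext_binomial_def moment_zeta_measure algebra_simps)

text \<open>By continuity it suffices that the function takes arbitrarily small and arbitrarily large values.  It is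
  small near 1 because the denominator \<open>zeta t\<close> blows up there while everything else stays bounded, and large for
  large \<open>t\<close> because the Gamma quotient grows at least like \<open>t powr \<rho>\<close> while the zeta quotient is at
  least \<open>1 / zeta 2\<close> from \<open>t = 2\<close> on.\<close>

lemma binomial_zeta_quotient_onto:
  assumes "\<rho> > 0"
  shows "(\<lambda>t. ext_binomial (t + \<rho> + real j) \<rho> * (zeta (t + \<rho>) / zeta t)) ` {1<..} = {0<..}"
    (is "?R ` _ = _")
proof -
  define G where "G = zeta.moment (Suc j) 0"
  have R: "?R t = G (t + \<rho>) / G t / Gamma (\<rho> + 1)" if "t > 1" for t
    using binomial_zeta_quotient[OF assms that] by (simp add: G_def)
  have G: "G t = Gamma (t + real (Suc j)) * zeta t" if "t > 1" for t
    using moment_zeta_measure[OF that] by (simp add: G_def)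
  have G_pos: "G t > 0" if "t > 1" for t
    using zeta.moment_0_pos[OF that] by (simp add: G_def)
  have G_cont: "isCont G t" if "t > 1" for t
    unfolding G_def using zeta.moment_has_derivative[OF that] DERIV_isCont by blast
  have Gamma_pos: "Gamma (\<rho> + 1) > 0"
    using assms by (intro Gamma_real_pos) auto
  have R_cont: "isCont (\<lambda>t. G (t + \<rho>) / G t / Gamma (\<rho> + 1)) t" if "t > 1" for t
    using G_cont[of t] isCont_o2[of t "\<lambda>t. t + \<rho>" G] G_cont[of "t + \<rho>"] that assms
      G_pos[of t] less_imp_neq[OF Gamma_pos] by (intro isCont_divide) auto
  have small: "\<exists>t>1. ?R t < y" if "y > 0" for y
  proof -
    have "isCont (\<lambda>t. G (t + \<rho>)) 1"
      using assms by (intro isCont_o2[of 1 "\<lambda>t. t + \<rho>" G] G_cont continuous_intros) auto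
    then have "((\<lambda>t. G (t + \<rho>)) \<longlongrightarrow> G (1 + \<rho>)) (at_right 1)"
      unfolding isCont_def by (rule tendsto_within_subset) auto
    moreover have "((\<lambda>t. Gamma (t + real (Suc j)) * Gamma (\<rho> + 1)) \<longlongrightarrow>
        Gamma (1 + real (Suc j)) * Gamma (\<rho> + 1)) (at_right 1)"
      by (intro tendsto_intros) (auto elim!: nonpos_Ints_cases)
    moreover have "Gamma (1 + real (Suc j)) * Gamma (\<rho> + 1) > 0"
      using mult_pos_pos[OF Gamma_real_pos Gamma_pos] by auto
    ultimately have "((\<lambda>t. G (t + \<rho>) / (Gamma (t + real (Suc j)) * Gamma (\<rho> + 1)) / zeta t) \<longlongrightarrow> 0)
        (at_right 1)"
      by (intro tendsto_divide_0[OF tendsto_divide]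
          filterlim_at_top_imp_at_infinity zeta_at_top_at_right_1) auto
    then have "\<forall>\<^sub>F t in at_right 1. G (t + \<rho>) / (Gamma (t + real (Suc j)) * Gamma (\<rho> + 1)) / zeta t < y"
      using that by (rule order_tendstoD)
    moreover have "\<forall>\<^sub>F t::real in at_right 1. t > 1"
      by (simp add: eventually_at_right_less)
    ultimately have "\<forall>\<^sub>F t in at_right 1. t > 1 \<and> ?R t < y"
    proof eventually_elim
      case (elim t)
      have "?R t = G (t + \<rho>) / (Gamma (t + real (Suc j)) * Gamma (\<rho> + 1)) / zeta t"
        unfolding R[OF elim(2)] G[OF elim(2)] by (simp only: divide_divide_eq_left mult_ac)
      with elim show ?case by (simp only:)
    qed
    then show ?thesis
      using eventually_happens'[OF trivial_limit_at_right_real] by blast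
  qed
  have large: "\<exists>t>1. ?R t > y" for y
  proof -
    \<comment> \<open>the maximum with 1 keeps \<open>K\<close> positive, so that \<open>K powr (1 / \<rho>)\<close> is a genuine root; the summand 2 in \<open>t\<close>
      makes the inequality strict and allows the comparison with \<open>zeta 2\<close>\<close>
    define K where "K = max 1 (y * (Gamma (\<rho> + 1) * zeta 2))"
    define t where "t = 2 + K powr (1 / \<rho>)"
    have "K = (K powr (1 / \<rho>)) powr \<rho>"
      using assms by (simp add: powr_powr K_def)
    also have "\<dots> < (t + real j) powr \<rho>"
      using assms by (intro powr_less_mono2) (auto simp: t_def)
    finally have t: "(t + real j) powr \<rho> > y * (Gamma (\<rho> + 1) * zeta 2)" "t \<ge> 2"
      by (auto simp: t_def K_def)
    have "y < (t + real j) powr \<rho> * (1 / zeta 2) / Gamma (\<rho> + 1)"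
      using t Gamma_pos zeta_ge_1[of 2] by (simp add: field_simps)
    also have "\<dots> \<le> (Gamma (t + real (Suc j) + \<rho>) / Gamma (t + real (Suc j)))
        * (zeta (t + \<rho>) / zeta t) / Gamma (\<rho> + 1)"
    proof (intro divide_right_mono mult_mono frac_le)
      show "(t + real j) powr \<rho> \<le> Gamma (t + real (Suc j) + \<rho>) / Gamma (t + real (Suc j))"
        using Gamma_quotient_lower_bound[of "t + real (Suc j)" \<rho>] t assms by simp
    qed (use t assms Gamma_pos zeta_ge_1[of "t + \<rho>"] zeta_ge_1[of t] zeta_antimono[of 2 t]
        in \<open>auto intro: Gamma_real_pos less_imp_le\<close>)
    also have "\<dots> = ?R t"
    proof -
      have "t > 1" "t + \<rho> > 1"
        using t assms by auto
      then show ?thesis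
        unfolding R[OF \<open>t > 1\<close>] G[OF \<open>t > 1\<close>] G[OF \<open>t + \<rho> > 1\<close>] by (simp add: add_ac)
    qed
    finally have "?R t > y" .
    then show ?thesis
      using t by (intro exI[of _ t] conjI) auto
  qed
  show ?thesis
  proof (intro equalityI subsetI)
    fix y assume "y \<in> ?R ` {1<..}"
    then obtain t where t: "t > 1" "y = ?R t"
      unfolding image_iff greaterThan_iff by blast
    have "y = G (t + \<rho>) / G t / Gamma (\<rho> + 1)"
      unfolding t(2) by (rule R[OF t(1)])
    then show "y \<in> {0<..}"
      using G_pos[of t] G_pos[of "t + \<rho>"] t assms Gamma_pos by simp
  next
    fix y :: real assume "y \<in> {0<..}"
    then obtain a b where ab: "a > 1" "?R a < y" "b > 1" "?R b > y"
      using small large unfolding greaterThan_iff by blast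
    have "continuous_on {1<..} (\<lambda>t. G (t + \<rho>) / G t / Gamma (\<rho> + 1))"
      using R_cont by (intro continuous_at_imp_continuous_on) auto
    then have "continuous_on {1<..} ?R"
      by (rule continuous_on_eq) (simp only: R greaterThan_iff)
    then have "connected (?R ` {1<..})"
      by (intro connected_continuous_image) auto
    moreover have "?R a \<in> ?R ` {1<..}" "?R b \<in> ?R ` {1<..}"
      using ab by (intro imageI; simp)+
    ultimately show "y \<in> ?R ` {1<..}"
      by (rule connectedD_interval) (use ab in \<open>simp_all only: less_imp_le\<close>)
  qed
qed

section \<open>Monotonicity and convexity results for the zeta function\<close>

lemma absolutely_convex_on_cong:
  assumes "absolutely_convex_on I f" "\<And>t. t \<in> I \<Longrightarrow> f t = g t"
  shows "absolutely_convex_on I g"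
  using assms unfolding absolutely_convex_on_def by simp

lemma log_convex_on_cong:
  assumes "log_convex_on I f" "\<And>t. t \<in> I \<Longrightarrow> f t = g t"
  shows "log_convex_on I g"
proof -
  have "convex I"
    using assms(1) by (auto simp: log_convex_on_def intro: convex_on_imp_convex)
  then show ?thesis
    using assms by (auto simp: log_convex_on_def convex_on_def convex_def)
qed

theorem theorem3p1:
  fixes \<rho> :: real
  assumes "\<rho> > 0"
  shows "(\<forall>j::nat.
            strict_mono_on {1<..}
              (\<lambda>t. ext_binomial (t + \<rho> + real j) \<rho> * (zeta (t + \<rho>) / zeta t)) \<and>
            (\<lambda>t. ext_binomial (t + \<rho> + real j) \<rho> * (zeta (t + \<rho>) / zeta t)) ` {1<..} = {0<..}) \<and>
         (\<forall>j::nat. absolutely_convex_on {1<..} (\<lambda>t. Gamma (t + real j) * zeta t)) \<and>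
         (\<forall>j::nat. j \<ge> 1 \<longrightarrow> log_convex_on {1<..} (\<lambda>t. Gamma (t + real j) * zeta t))"
proof (intro conjI allI impI)
  fix j :: nat
  have "Gamma (\<rho> + 1) > 0"
    using assms by (intro Gamma_real_pos) auto
  then show "strict_mono_on {1<..} (\<lambda>t. ext_binomial (t + \<rho> + real j) \<rho> * (zeta (t + \<rho>) / zeta t))"
    using assms strict_mono_onD[OF zeta.moment_ratio_strict_mono[OF assms, of "Suc j"]]
    by (intro strict_mono_onI)
      (simp only: binomial_zeta_quotient greaterThan_iff divide_strict_right_mono)
  show "(\<lambda>t. ext_binomial (t + \<rho> + real j) \<rho> * (zeta (t + \<rho>) / zeta t)) ` {1<..} = {0<..}"
    using assms by (rule binomial_zeta_quotient_onto)
  show "absolutely_convex_on {1<..} (\<lambda>t. Gamma (t + real j) * zeta t)"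
    by (rule absolutely_convex_on_cong[OF zeta.absolutely_convex_moment[of j]])
      (simp add: moment_zeta_measure)
  show "log_convex_on {1<..} (\<lambda>t. Gamma (t + real j) * zeta t)"
    by (rule log_convex_on_cong[OF zeta.log_convex_moment[of j]])
      (simp add: moment_zeta_measure)
qed

end
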